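(* For a Tychonoff space $X$, the following assertions are equivalent: (i) $X$ is a $k_{\mathbb{R}}$-space; (ii) for every compact (Hausdorff) space $K$, the product $X\times K$ is a $k_{\mathbb{R}}$-space; (iii) for every compact (Hausdorff) space $K$, each $k$-continuous function $f:X\times K\to\mathbb{R}$ is continuous.
   Context: All spaces are assumed to be Tychonoff. A function $f:Z\to\mathbb{R}$ on a space $Z$ is $k$-continuous if its restriction to every compact subset of $Z$ is continuous. A space $Z$ is a $k_{\mathbb{R}}$-space if every $k$-continuous function $f:Z\to\mathbb{R}$ is continuous. *)

theory Defs
  imports "HOL-Analysis.Analysis"
begin

definition tychonoff_space :: "'a topology \<Rightarrow> bool" where
  "tychonoff_space Z \<longleftrightarrow> completely_regular_space Z \<and> Hausdorff_space Z"

definition k_continuous :: "'a topology \<Rightarrow> ('a \<Rightarrow> real) \<Rightarrow> bool" where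
  "k_continuous Z f \<longleftrightarrow>
     (\<forall>C. compactin Z C \<longrightarrow> continuous_map (subtopology Z C) euclideanreal f)"

(* The Tychonoff property is not part of this definition; it is a separate hypothesis on the
   base space, and the product of a Tychonoff space with a compact Hausdorff space inherits it. *)
definition kR_space :: "'a topology \<Rightarrow> bool" where
  "kR_space Z \<longleftrightarrow>
     (\<forall>f :: 'a \<Rightarrow> real. k_continuous Z f \<longrightarrow> continuous_map Z euclideanreal f)"

end

theory Submission
  imports Defs
begin

text \<open>The nontrivial direction: let \<open>f\<close> be k-continuous on \<open>X \<times> K\<close> with \<open>K\<close> compact, and fix
  a point \<open>x0\<close>. The function \<open>g x = (SUP y. \<bar>f (x, y) - f (x0, y)\<bar>)\<close> is k-continuous,
  because suprema along a compact factor preserve continuity; hence \<open>g\<close> is continuous when \<open>X\<close> is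
  a k_R-space. The function \<open>f\<close> is squeezed between the continuous functions
  \<open>f (x0, y) - g x\<close> and \<open>f (x0, y) + g x\<close>, which agree with \<open>f\<close> at \<open>x = x0\<close>. For the
  converse take \<open>K\<close> to be a single point.\<close>

text \<open>Strict superlevel sets of the supremum are projections of open sets, hence open.
  Complements of strict sublevel sets are projections of closed sets, hence closed because
  projecting along a compact factor is a closed map.\<close>

lemma continuous_map_SUP_compact:
  fixes G :: "'a \<times> 'b \<Rightarrow> real"
  assumes K: "compact_space K" "topspace K \<noteq> {}"
    and G: "continuous_map (prod_topology T K) euclideanreal G"
  shows "continuous_map T euclideanreal (\<lambda>x. SUP y\<in>topspace K. G (x, y))"
proof -
  have cpt: "compact ((\<lambda>y. G (x, y)) ` topspace K)" if "x \<in> topspace T" for x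
  proof -
    have "continuous_map K euclideanreal (G \<circ> (\<lambda>y. (x, y)))"
      using G by (rule continuous_map_compose[rotated]) (use that in \<open>auto intro: continuous_intros\<close>)
    then show ?thesis
      using K(1) image_compactin by (fastforce simp: compact_space_def o_def)
  qed
  \<comment> \<open>Boundedness suffices for \<open>less_SUP\<close>. For \<open>SUP_less\<close>
    the supremum must be attained: strict bounds on all values could otherwise degenerate to
    equality in the limit.\<close>
  have SUP_less: "(SUP y\<in>topspace K. G (x, y)) < a \<longleftrightarrow> (\<forall>y\<in>topspace K. G (x, y) < a)"
    and less_SUP: "a < (SUP y\<in>topspace K. G (x, y)) \<longleftrightarrow> (\<exists>y\<in>topspace K. a < G (x, y))"
    if x: "x \<in> topspace T" for x a
  proof -
    have bdd: "bdd_above ((\<lambda>y. G (x, y)) ` topspace K)"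
      using cpt[OF x] by (simp add: bounded_imp_bdd_above compact_imp_bounded)
    show "a < (SUP y\<in>topspace K. G (x, y)) \<longleftrightarrow> (\<exists>y\<in>topspace K. a < G (x, y))"
      by (rule less_cSUP_iff[OF K(2) bdd])
    obtain z where z: "z \<in> topspace K" "\<And>y. y \<in> topspace K \<Longrightarrow> G (x, y) \<le> G (x, z)"
      using compact_attains_sup[OF cpt[OF x]] K(2) by auto
    have "(SUP y\<in>topspace K. G (x, y)) = G (x, z)"
      using z by (intro cSup_eq_maximum) auto
    with z show "(SUP y\<in>topspace K. G (x, y)) < a \<longleftrightarrow> (\<forall>y\<in>topspace K. G (x, y) < a)"
      by force
  qed
  show ?thesis
    unfolding continuous_map_upper_lower_semicontinuous_lt
  proof (intro allI conjI)
    fix a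
    have "openin (prod_topology T K) {p \<in> topspace (prod_topology T K). a < G p}"
      using G by (simp add: continuous_map_upper_lower_semicontinuous_lt)
    then have "openin T (fst ` {p \<in> topspace (prod_topology T K). a < G p})"
      using open_map_fst open_map_def by blast
    also have "fst ` {p \<in> topspace (prod_topology T K). a < G p} =
        {x \<in> topspace T. a < (SUP y\<in>topspace K. G (x, y))}"
      using less_SUP by (force simp: image_iff)
    finally show "openin T {x \<in> topspace T. a < (SUP y\<in>topspace K. G (x, y))}" .
    have "closedin (prod_topology T K) {p \<in> topspace (prod_topology T K). a \<le> G p}"
      using G by (simp add: continuous_map_upper_lower_semicontinuous_le)
    then have "closedin T (fst ` {p \<in> topspace (prod_topology T K). a \<le> G p})"
      using closed_map_fst[OF K(1)] closed_map_def by blast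
    then have "openin T (topspace T - fst ` {p \<in> topspace (prod_topology T K). a \<le> G p})"
      by blast
    also have "topspace T - fst ` {p \<in> topspace (prod_topology T K). a \<le> G p} =
        {x \<in> topspace T. (SUP y\<in>topspace K. G (x, y)) < a}"
      using SUP_less by (force simp: image_iff not_le)
    finally show "openin T {x \<in> topspace T. (SUP y\<in>topspace K. G (x, y)) < a}" .
  qed
qed

lemma kR_space_prod_compact:
  assumes X: "kR_space X" and K: "compact_space K"
  shows "kR_space (prod_topology X K)"
  unfolding kR_space_def
proof (intro allI impI)
  fix f :: "'a \<times> 'b \<Rightarrow> real"
  assume f: "k_continuous (prod_topology X K) f"
  let ?P = "prod_topology X K"
  \<comment> \<open>\<open>C \<times> K\<close> is compact in the product, so k-continuity of
    \<open>f\<close> applies to it.\<close>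
  have f_on: "continuous_map (prod_topology (subtopology X C) K) euclideanreal f"
    if "compactin X C" for C
    using f that K unfolding k_continuous_def compact_space_def
    by (metis compactin_Times prod_topology_subtopology(1) subtopology_Times subtopology_topspace)
  \<comment> \<open>Continuous minorants touching \<open>f\<close> at every point will give lower
    semicontinuity, and majorants upper semicontinuity.\<close>
  have minorant: "\<exists>L. continuous_map ?P euclideanreal L \<and> L p = f p \<and> (\<forall>q\<in>topspace ?P. L q \<le> f q)"
    and majorant: "\<exists>U. continuous_map ?P euclideanreal U \<and> U p = f p \<and> (\<forall>q\<in>topspace ?P. f q \<le> U q)"
    if "p \<in> topspace ?P" for p
  proof -
    obtain x0 y0 where p: "p = (x0, y0)" and x0: "x0 \<in> topspace X" and y0: "y0 \<in> topspace K"
      using \<open>p \<in> topspace ?P\<close> by (cases p) auto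
    define G where "G = (\<lambda>(x, y). \<bar>f (x, y) - f (x0, y)\<bar>)"
    define g where "g = (\<lambda>x. SUP y\<in>topspace K. G (x, y))"
    \<comment> \<open>Singletons are compact, so \<open>f_on\<close> applies with
      \<open>C = {x}\<close>.\<close>
    have slice: "continuous_map K euclideanreal (\<lambda>y. f (x, y))" if "x \<in> topspace X" for x
    proof -
      have "continuous_map K euclideanreal (f \<circ> (\<lambda>y. (x, y)))"
        by (rule continuous_map_compose[OF _ f_on[of "{x}"]])
          (use that in \<open>auto intro!: continuous_intros simp: continuous_map_pairwise o_def\<close>)
      then show ?thesis by (simp add: o_def)
    qed
    \<comment> \<open>\<open>T\<close> is kept general: \<open>G_on\<close> uses a compact subspace
      of \<open>X\<close>, the final bounds use \<open>X\<close> itself.\<close>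
    have slice_snd: "continuous_map (prod_topology T K) euclideanreal (\<lambda>q. f (x0, snd q))" for T :: "'a topology"
      using continuous_map_compose[OF continuous_map_snd slice[OF x0]] by (simp add: o_def)
    have G_on: "continuous_map (prod_topology (subtopology X C) K) euclideanreal G"
      if "compactin X C" for C
      unfolding G_def case_prod_unfold
      using continuous_map_diff[OF f_on[OF that] slice_snd] by (auto intro: continuous_map_real_abs)
    \<comment> \<open>The supremum lemma is applied over each compact subspace of \<open>X\<close>
      separately, since only there is \<open>G\<close> known to be continuous.\<close>
    have "k_continuous X g"
      unfolding k_continuous_def g_def
      using continuous_map_SUP_compact[OF K _ G_on] y0 by blast
    then have "continuous_map X euclideanreal g"
      using X by (simp add: kR_space_def)
    then have g: "continuous_map ?P euclideanreal (\<lambda>q. g (fst q))"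
      using continuous_map_compose[OF continuous_map_fst] by (force simp: o_def)
    have G_le: "\<bar>f (x, y) - f (x0, y)\<bar> \<le> g x" if "x \<in> topspace X" "y \<in> topspace K" for x y
    proof -
      have "continuous_map K euclideanreal (\<lambda>y. G (x, y))"
        using slice that(1) x0 by (auto simp: G_def intro!: continuous_map_real_abs continuous_map_diff)
      then have "compact ((\<lambda>y. G (x, y)) ` topspace K)"
        using K image_compactin by (fastforce simp: compact_space_def)
      then have "G (x, y) \<le> g x"
        unfolding g_def using that(2)
        by (intro cSUP_upper) (simp_all add: bounded_imp_bdd_above compact_imp_bounded)
      then show ?thesis by (simp add: G_def)
    qed
    \<comment> \<open>\<open>G (x0, y)\<close> vanishes for all \<open>y\<close>, so this is the
      supremum of the constant 0; \<open>y0\<close> makes the index set nonempty.\<close>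
    have g0: "g x0 = 0"
      using y0 by (subst cSUP_const[of "topspace K" "0::real", symmetric]) (auto simp: g_def G_def)
    show "\<exists>L. continuous_map ?P euclideanreal L \<and> L p = f p \<and> (\<forall>q\<in>topspace ?P. L q \<le> f q)"
      using continuous_map_diff[OF slice_snd g] G_le g0 p
      by (intro exI[of _ "\<lambda>q. f (x0, snd q) - g (fst q)"]) (force simp: abs_le_iff)
    show "\<exists>U. continuous_map ?P euclideanreal U \<and> U p = f p \<and> (\<forall>q\<in>topspace ?P. f q \<le> U q)"
      using continuous_map_add[OF slice_snd g] G_le g0 p
      by (intro exI[of _ "\<lambda>q. f (x0, snd q) + g (fst q)"]) (force simp: abs_le_iff)
  qed
  show "continuous_map ?P euclideanreal f"
    unfolding continuous_map_upper_lower_semicontinuous_lt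
  proof (intro allI conjI)
    fix a
    \<comment> \<open>The superlevel set of a minorant touching \<open>f\<close> at \<open>p\<close>
      is an open neighbourhood of \<open>p\<close> inside the superlevel set of \<open>f\<close>.
      Majorants serve the sublevel sets below in the same way.\<close>
    show "openin ?P {q \<in> topspace ?P. a < f q}"
    proof (subst openin_subopen, intro ballI)
      fix p assume p: "p \<in> {q \<in> topspace ?P. a < f q}"
      then obtain L where L: "continuous_map ?P euclideanreal L" "L p = f p"
          "\<forall>q\<in>topspace ?P. L q \<le> f q"
        using minorant by blast
      have "openin ?P {q \<in> topspace ?P. a < L q}"
        using L(1) by (simp add: continuous_map_upper_lower_semicontinuous_lt)
      then show "\<exists>T. openin ?P T \<and> p \<in> T \<and> T \<subseteq> {q \<in> topspace ?P. a < f q}"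
        by (rule_tac x="{q \<in> topspace ?P. a < L q}" in exI) (use L p in force)
    qed
    show "openin ?P {q \<in> topspace ?P. f q < a}"
    proof (subst openin_subopen, intro ballI)
      fix p assume p: "p \<in> {q \<in> topspace ?P. f q < a}"
      then obtain U where U: "continuous_map ?P euclideanreal U" "U p = f p"
          "\<forall>q\<in>topspace ?P. f q \<le> U q"
        using majorant by blast
      have "openin ?P {q \<in> topspace ?P. U q < a}"
        using U(1) by (simp add: continuous_map_upper_lower_semicontinuous_lt)
      then show "\<exists>T. openin ?P T \<and> p \<in> T \<and> T \<subseteq> {q \<in> topspace ?P. f q < a}"
        by (rule_tac x="{q \<in> topspace ?P. U q < a}" in exI) (use U p in force)
    qed
  qed
qed

text \<open>Projection sends compact sets to compact sets, so a k-continuous \<open>f\<close> lifts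
  to the k-continuous \<open>f \<circ> fst\<close>. Restricting the lift to the slice at
  \<open>b\<close> recovers \<open>f\<close>.\<close>

lemma kR_space_factor:
  assumes XK: "kR_space (prod_topology X K)" and b: "b \<in> topspace K"
  shows "kR_space X"
  unfolding kR_space_def
proof (intro allI impI)
  fix f :: "'a \<Rightarrow> real"
  assume f: "k_continuous X f"
  have "k_continuous (prod_topology X K) (f \<circ> fst)"
    unfolding k_continuous_def
  proof (intro allI impI)
    fix C assume "compactin (prod_topology X K) C"
    then have "compactin X (fst ` C)"
      using image_compactin continuous_map_fst by blast
    then have "continuous_map (subtopology X (fst ` C)) euclideanreal f"
      using f by (simp add: k_continuous_def)
    moreover have "continuous_map (subtopology (prod_topology X K) C) (subtopology X (fst ` C)) fst"
      by (auto simp: continuous_map_in_subtopology continuous_map_from_subtopology continuous_map_fst)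
    ultimately show "continuous_map (subtopology (prod_topology X K) C) euclideanreal (f \<circ> fst)"
      by (rule continuous_map_compose[rotated])
  qed
  then have "continuous_map (prod_topology X K) euclideanreal (f \<circ> fst)"
    using XK by (simp add: kR_space_def)
  moreover have "continuous_map X (prod_topology X K) (\<lambda>x. (x, b))"
    using b by (simp add: continuous_map_pairwise o_def)
  ultimately have "continuous_map X euclideanreal ((f \<circ> fst) \<circ> (\<lambda>x. (x, b)))"
    by (rule continuous_map_compose[rotated])
  then show "continuous_map X euclideanreal f"
    by (simp add: o_def)
qed

theorem theorem4p3:
  fixes X :: "'a topology"
  assumes "tychonoff_space X"
  shows
    "(kR_space X \<longleftrightarrow>
        (\<forall>K :: 'b topology. compact_space K \<and> Hausdorff_space K \<longrightarrow>
           kR_space (prod_topology X K))) \<and>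
     (kR_space X \<longleftrightarrow>
        (\<forall>K :: 'b topology. compact_space K \<and> Hausdorff_space K \<longrightarrow>
           (\<forall>f :: 'a \<times> 'b \<Rightarrow> real. k_continuous (prod_topology X K) f \<longrightarrow>
              continuous_map (prod_topology X K) euclideanreal f)))"
proof -
  have "kR_space X"
    if "\<forall>K :: 'b topology. compact_space K \<and> Hausdorff_space K \<longrightarrow> kR_space (prod_topology X K)"
  proof -
    \<comment> \<open>A one-point space over the type \<open>'b\<close>; \<open>undefined\<close>
      merely names some element, as every type is inhabited.\<close>
    let ?K = "discrete_topology {undefined :: 'b}"
    have "kR_space (prod_topology X ?K)"
      using that by (simp add: compact_space_discrete_topology)
    then show ?thesis
      by (rule kR_space_factor) simp
  qed
  then have *: "kR_space X \<longleftrightarrow> (\<forall>K :: 'b topology. compact_space K \<and> Hausdorff_space K \<longrightarrow>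
      kR_space (prod_topology X K))"
    using kR_space_prod_compact by blast
  \<comment> \<open>Assertion (iii) is (ii) with \<open>kR_space\<close> unfolded at the
    product.\<close>
  then show ?thesis
    by (simp add: kR_space_def[of "prod_topology _ _"])
qed

end
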